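(* Let $C_n$ denote the cycle on $n$ vertices. If $n\geq 5$, then $(C_n)^3$ is $5$-ordered Hamiltonian.
   Context: All graphs are finite simple graphs. $d_G(v,w)$ denotes the distance in $G$ between vertices $v$ and $w$. For a positive integer $p$, the $p$-th power $G^p$ of a graph $G$ is the simple graph with the same vertex set as $G$ in which two distinct vertices $v,w$ are adjacent if and only if $d_G(v,w)\leq p$. A graph $G$ is $k$-ordered Hamiltonian if for any sequence $v_1,v_2,\dots,v_k$ of $k$ distinct vertices of $G$ there is a Hamiltonian cycle in $G$ containing these vertices in the given order, i.e. traversing the cycle from $v_1$ in one of its two directions, one meets $v_1,v_2,\dots,v_k$ in this order before returning to $v_1$. *)

theory Defs
  imports "Graph_Theory.Graph_Theory" "HOL-Library.Sublist"
begin

text \<open>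
  A finite simple graph is a finite, loop-free, symmetric pair digraph
  (locale \<^locale>\<open>pair_graph\<close>): each edge is represented by its two arcs.
\<close>

text \<open>
  The cycle on the vertices 0, ..., n - 1. This is a simple graph for \<open>n \<ge> 2\<close>
  and a cycle only for \<open>n \<ge> 3\<close>.
\<close>

definition cycle_graph :: "nat \<Rightarrow> nat pair_pre_digraph" where
  "cycle_graph n =
     \<lparr> pverts = {..<n},
       parcs = {(i, j). i < n \<and> j < n \<and> (j = Suc i mod n \<or> i = Suc j mod n)} \<rparr>"

text \<open>
  The distance is the length of a shortest walk, i.e. the shortest-path cost for unit
  arc weights; it is \<open>\<infinity>\<close> for vertices in different components.
\<close>

definition graph_dist :: "'a pair_pre_digraph \<Rightarrow> 'a \<Rightarrow> 'a \<Rightarrow> ereal" where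
  "graph_dist G v w = wf_digraph.\<mu> (with_proj G) (\<lambda>_. 1) v w"

definition graph_power :: "'a pair_pre_digraph \<Rightarrow> nat \<Rightarrow> 'a pair_pre_digraph" where
  "graph_power G p =
     \<lparr> pverts = pverts G,
       parcs = {(v, w). v \<in> pverts G \<and> w \<in> pverts G \<and> v \<noteq> w \<and>
                        graph_dist G v w \<le> ereal (real p)} \<rparr>"

text \<open>
  A cycle is a closed walk, given as a list of arcs, so it carries a start vertex and a
  direction; \<open>map fst c\<close> lists each of its vertices once, in order of traversal.
  The bound on the length excludes going back and forth along a single edge, which
  \<^const>\<open>pre_digraph.cycle\<close> admits.
\<close>

definition hamiltonian_cycle :: "'a pair_pre_digraph \<Rightarrow> ('a \<times> 'a) list \<Rightarrow> bool" where
  "hamiltonian_cycle G c \<longleftrightarrow>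
     pre_digraph.cycle (with_proj G) c \<and> 3 \<le> length c \<and> set (map fst c) = pverts G"

text \<open>
  The existential over arc lists ranges over both directions of a Hamiltonian cycle.
\<close>

definition k_ordered_hamiltonian :: "nat \<Rightarrow> 'a pair_pre_digraph \<Rightarrow> bool" where
  "k_ordered_hamiltonian k G \<longleftrightarrow>
     (\<forall>vs. length vs = k \<and> distinct vs \<and> set vs \<subseteq> pverts G \<longrightarrow>
        (\<exists>c. hamiltonian_cycle G c \<and>
             (vs \<noteq> [] \<longrightarrow> hd (map fst c) = hd vs) \<and>
             subseq vs (map fst c)))"

lemma pair_graph_cycle_graph:
  assumes "2 \<le> n"
  shows "pair_graph (cycle_graph n)"
proof
  show "finite (parcs (cycle_graph n))"
    by (rule finite_subset[of _ "{..<n} \<times> {..<n}"]) (auto simp: cycle_graph_def)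
  show "symmetric (with_proj (cycle_graph n))"
    by (auto simp: symmetric_def sym_def cycle_graph_def)
  show "fst e \<noteq> snd e" if "e \<in> parcs (cycle_graph n)" for e
    using that assms by (auto simp: cycle_graph_def mod_Suc split: if_splits)
qed (auto simp: cycle_graph_def)

lemma graph_dist_commute:
  assumes "pair_graph G"
  shows "graph_dist G v w = graph_dist G w v"
proof -
  interpret pair_graph G by (rule assms)
  have len: "length (rev_path p) = length p" for p :: "('a \<times> 'a) list"
    by (induct p) auto
  have cost: "awalk_cost (\<lambda>_. 1) p = real (length p)" for p :: "('a \<times> 'a) list"
    by (simp add: awalk_cost_def sum_list_triv)
  have le: "graph_dist G a b \<le> graph_dist G b a" for a b
    unfolding graph_dist_def \<mu>_def[of _ b a]
  proof (rule INF_greatest)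
    fix p assume "p \<in> {p. awalk b p a}"
    then have "awalk a (rev_path p) b" by simp
    from min_cost_le_walk_cost[OF this, of "\<lambda>_. 1"]
    show "\<mu> (\<lambda>_. 1) a b \<le> ereal (awalk_cost (\<lambda>_. 1) p)" by (simp add: cost len)
  qed
  show ?thesis by (rule antisym) (rule le)+
qed

lemma pair_graph_graph_power:
  assumes "pair_graph G"
  shows "pair_graph (graph_power G p)"
proof
  interpret pair_graph G by (rule assms)
  show "finite (pverts (graph_power G p))"
    by (simp add: graph_power_def)
  show "finite (parcs (graph_power G p))"
    by (rule finite_subset[of _ "pverts G \<times> pverts G"]) (auto simp: graph_power_def)
  show "symmetric (with_proj (graph_power G p))"
    using graph_dist_commute[OF assms]
    by (auto simp: symmetric_def sym_def graph_power_def)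
qed (auto simp: graph_power_def)

end

theory Submission
  imports Defs
begin

text \<open>
  A closed walk in \<open>C\<^sub>n\<close>, possibly pausing, gives a Hamiltonian cycle of the cube as soon as one can
  select positions of the walk that hit every vertex exactly once and leave no three consecutive
  positions unselected. Let the five prescribed vertices be \<open>0, 1, 2, 3, 4\<close> in their order around
  the cycle. Up to rotation and reversal there are four kinds of prescribed orders.
  For \<open>01234\<close> go around the cycle. For \<open>02413\<close> go around twice, visiting \<open>0, 2, 4\<close> in the first
  round and \<open>1, 3\<close> in the second. For \<open>01243\<close> and \<open>01342\<close> go around once and then retrace the same
  path, visiting \<open>0, 1, 2, 4\<close> (respectively \<open>0, 1, 3, 4\<close>) on the way out and the remaining vertex on
  the way back. The other vertices are split between the two passes so that no three consecutive
  ones belong to the same pass; letting the passes alternate outside the prescribed vertices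
  nearly always achieves this.
\<close>

section \<open>Cyclic vertex lists as Hamiltonian cycles\<close>

lemma awalk_zip:
  assumes "successively (\<lambda>v w. (v, w) \<in> parcs G) (u # xs @ [v])"
  shows "pcas u (zip (u # xs) (xs @ [v])) v"
    and "pawalk_verts u (zip (u # xs) (xs @ [v])) = u # xs @ [v]"
    and "set (zip (u # xs) (xs @ [v])) \<subseteq> parcs G"
  using assms by (induction xs arbitrary: u) auto

lemma hamiltonian_cycle_zip:
  assumes "distinct (u # xs)" "2 \<le> length xs" "set (u # xs) = pverts G"
    and "successively (\<lambda>v w. (v, w) \<in> parcs G) (u # xs @ [u])"
  shows "hamiltonian_cycle G (zip (u # xs) (xs @ [u]))"
proof -
  have "map fst (zip (u # xs) (xs @ [u])) = u # xs"
    by (simp add: map_fst_zip del: zip_Cons_Cons)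
  moreover have "pre_digraph.cycle (with_proj G) (zip (u # xs) (xs @ [u]))"
    unfolding pre_digraph.cycle_def pre_digraph.awalk_def
    using awalk_zip[OF assms(4)] assms(1,3)
    by (intro exI[of _ u])
      (auto simp: cas_with_proj_eq awalk_verts_with_proj_eq simp del: zip_Cons_Cons)
  ultimately show ?thesis
    using assms(2,3) by (simp add: hamiltonian_cycle_def del: zip_Cons_Cons)
qed

text \<open>A fixed start \<open>v\<close> makes the required order linear. \<open>A\<close> stands
  for closeness only and may be reflexive, since \<open>distinct\<close> already separates the
  vertices.\<close>

definition ordered_tour :: "'a set \<Rightarrow> ('a \<Rightarrow> 'a \<Rightarrow> bool) \<Rightarrow> 'a \<Rightarrow> 'a list \<Rightarrow> bool" where
  "ordered_tour V A v ws \<longleftrightarrow>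
     (\<exists>xs. distinct (v # xs) \<and> set (v # xs) = V \<and> successively A (v # xs @ [v]) \<and> subseq ws xs)"

text \<open>Cutting \<open>v # ys @ w # zs\<close> before \<open>w\<close> and swapping the pieces
  gives the tour from \<open>w\<close>; \<open>ws\<close> lies in \<open>zs\<close>, hence before
  \<open>v\<close>.\<close>

lemma ordered_tour_rotate:
  assumes "ordered_tour V A v (w # ws)"
  shows "ordered_tour V A w (ws @ [v])"
proof -
  obtain xs where xs: "distinct (v # xs)" "set (v # xs) = V" "successively A (v # xs @ [v])"
    "subseq (w # ws) xs"
    using assms by (auto simp: ordered_tour_def)
  obtain ys zs where yz: "xs = ys @ w # zs" "subseq ws zs"
    using list_emb_ConsD[OF xs(4)] by blast
  have "subseq (ws @ [v]) (zs @ v # ys)"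
    using list_emb_append_mono[OF yz(2), of "[v]" "v # ys"] by simp
  moreover have "successively A ((w # zs) @ [v])" "successively A ((v # ys) @ [w])"
    using xs(3) successively_append_iff[of A "v # ys" "(w # zs) @ [v]"]
      successively_append_iff[of A "v # ys" "[w]"] by (auto simp: yz(1))
  then have "successively A (w # (zs @ v # ys) @ [w])"
    unfolding append_Cons[symmetric] append_assoc[symmetric] successively_append_iff by simp
  moreover have "distinct (w # zs @ v # ys)" "set (w # zs @ v # ys) = V"
    using xs(1,2) by (auto simp: yz(1))
  ultimately show ?thesis
    unfolding ordered_tour_def by blast
qed

lemma subseq_rev: "subseq xs ys \<Longrightarrow> subseq (rev xs) (rev ys)"
proof (induction rule: list_emb.induct)
  case (list_emb_Cons2 x y xs ys)
  then show ?case using list_emb_append_mono[of _ "rev xs" "rev ys" "[x]" "[y]"] by auto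
qed (auto intro: subseq_rev_drop_many)

lemma ordered_tour_rev:
  assumes "ordered_tour V A v ws" "symp A"
  shows "ordered_tour V A v (rev ws)"
proof -
  obtain xs where xs: "distinct (v # xs)" "set (v # xs) = V" "successively A (v # xs @ [v])"
    "subseq ws xs"
    using assms by (auto simp: ordered_tour_def)
  have "successively (\<lambda>x y. A y x) (v # xs @ [v])"
    using xs(3) assms(2) by (auto elim!: successively_mono dest: sympD)
  then have "successively A (rev (v # xs @ [v]))"
    by (simp only: successively_rev)
  with xs show ?thesis
    unfolding ordered_tour_def by (intro exI[of _ "rev xs"]) (auto intro: subseq_rev)
qed

lemma successively_neq_distinct: "distinct xs \<Longrightarrow> successively (\<noteq>) xs"
  by (induction xs rule: induct_list012) auto

lemma k_ordered_hamiltonian_graph_power: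
  assumes "pair_graph G" "3 \<le> card (pverts G)" "0 < k"
    and tour: "\<And>v ws. distinct (v # ws) \<Longrightarrow> length (v # ws) = k \<Longrightarrow> set (v # ws) \<subseteq> pverts G \<Longrightarrow>
      ordered_tour (pverts G) (\<lambda>v w. graph_dist G v w \<le> ereal (real p)) v ws"
  shows "k_ordered_hamiltonian k (graph_power G p)"
  unfolding k_ordered_hamiltonian_def
proof (intro allI impI)
  fix vs assume vs: "length vs = k \<and> distinct vs \<and> set vs \<subseteq> pverts (graph_power G p)"
  with \<open>0 < k\<close> obtain v ws where v: "vs = v # ws" by (cases vs) auto
  obtain xs where xs: "distinct (v # xs)" "set (v # xs) = pverts G" "subseq ws xs"
    "successively (\<lambda>v w. graph_dist G v w \<le> ereal (real p)) (v # xs @ [v])"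
    using tour[of v ws] vs unfolding v ordered_tour_def by (auto simp: graph_power_def)
  have len: "2 \<le> length xs"
    using distinct_card[OF xs(1)] assms(2) by (simp add: xs(2)[symmetric])
  \<comment> \<open>Closeness allows loops, arcs of the power do not. At the closing step,
    \<open>xs\<close> being nonempty rules out the pair \<open>v\<close>, \<open>v\<close>.\<close>
  then have "successively (\<noteq>) (v # xs @ [v])"
    unfolding append_Cons[symmetric] successively_append_iff
    using xs(1) successively_neq_distinct[OF xs(1)] by auto
  with xs(4) have "successively (\<lambda>v w. v \<noteq> w \<and> graph_dist G v w \<le> ereal (real p)) (v # xs @ [v])"
    by (simp add: successively_conv_nth)
  then have arcs: "successively (\<lambda>v w. (v, w) \<in> parcs (graph_power G p)) (v # xs @ [v])"
    by (rule successively_mono) (use xs(2) in \<open>auto simp: graph_power_def\<close>)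
  show "\<exists>c. hamiltonian_cycle (graph_power G p) c \<and>
      (vs \<noteq> [] \<longrightarrow> hd (map fst c) = hd vs) \<and> subseq vs (map fst c)"
    using hamiltonian_cycle_zip[OF xs(1) len _ arcs] xs(2,3)
    by (intro exI[of _ "zip (v # xs) (xs @ [v])"])
      (auto simp: v graph_power_def map_fst_zip simp del: zip_Cons_Cons)
qed

section \<open>Tours from lazy walks\<close>

text \<open>Induction on \<open>m\<close>, carrying the last selected position \<open>l\<close>: a
  jump longer than 3 would leave \<open>l + 1\<close>, \<open>l + 2\<close>, \<open>l + 3\<close>
  unselected, against \<open>gap\<close>.\<close>

lemma successively_filter_upt:
  assumes "a < m" "c a"
    and gap: "\<forall>i\<ge>a. Suc (Suc i) < m \<longrightarrow> c i \<or> c (Suc i) \<or> c (Suc (Suc i))"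
  shows "\<exists>xs l. filter c [a..<m] = xs @ [l] \<and> successively (\<lambda>i j. i < j \<and> j \<le> i + 3) (xs @ [l]) \<and>
    a \<le> l \<and> l < m \<and> (\<forall>i. l < i \<and> i < m \<longrightarrow> \<not> c i)"
  using \<open>a < m\<close> gap
proof (induction m)
  case (Suc m)
  show ?case
  proof (cases "m = a")
    case True
    then show ?thesis using \<open>c a\<close> by (intro exI[of _ "[]"] exI[of _ a]) auto
  next
    case False
    with Suc.prems(1) have "a < m" by simp
    then obtain xs l where xs: "filter c [a..<m] = xs @ [l]"
      "successively (\<lambda>i j. i < j \<and> j \<le> i + 3) (xs @ [l])" "a \<le> l" "l < m"
      and nc: "\<And>i. l < i \<Longrightarrow> i < m \<Longrightarrow> \<not> c i"
      using Suc.IH Suc.prems(2) less_SucI by blast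
    have "m \<le> l + 3"
    proof (rule ccontr)
      assume *: "\<not> m \<le> l + 3"
      then have "\<not> c (Suc l)" "\<not> c (Suc (Suc l))" "\<not> c (Suc (Suc (Suc l)))"
        by (intro nc; linarith)+
      with Suc.prems(2)[rule_format, of "Suc l"] * \<open>a \<le> l\<close> show False by linarith
    qed
    show ?thesis
    proof (cases "c m")
      case True
      have "filter c [a..<Suc m] = (xs @ [l]) @ [m]"
        using True \<open>a < m\<close> xs(1) by simp
      moreover have "successively (\<lambda>i j. i < j \<and> j \<le> i + 3) ((xs @ [l]) @ [m])"
        unfolding successively_append_iff[of _ "xs @ [l]"] using xs \<open>m \<le> l + 3\<close> by simp
      ultimately show ?thesis
        using \<open>a < m\<close> by (intro exI[of _ "xs @ [l]"] exI[of _ m] conjI) auto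
    next
      case False
      then show ?thesis
        using xs nc \<open>a < m\<close> by (intro exI[of _ xs] exI[of _ l] conjI) (auto simp: less_Suc_eq)
    qed
  qed
qed simp

text \<open>Position \<open>b\<close> is the return to the start: selected, so that the last jump is
  bounded too, but left out of \<open>bij\<close> because \<open>z b = z a\<close>.\<close>

lemma ordered_tour_filter_walk:
  fixes z :: "nat \<Rightarrow> 'a"
  assumes "a < b" "c a" "c b" "z b = z a"
    and gap: "\<And>i. a \<le> i \<Longrightarrow> Suc (Suc i) \<le> b \<Longrightarrow> c i \<or> c (Suc i) \<or> c (Suc (Suc i))"
    and near: "\<And>i j. a \<le> i \<Longrightarrow> i \<le> j \<Longrightarrow> j \<le> b \<Longrightarrow> j \<le> i + 3 \<Longrightarrow> A (z i) (z j)"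
    and bij: "bij_betw z {i \<in> {a..<b}. c i} V"
    and js: "sorted_wrt (<) js" "set js \<subseteq> {i \<in> {a<..<b}. c i}"
  shows "ordered_tour V A (z a) (map z js)"
proof -
  define ks where "ks = filter c [Suc a..<b]"
  have ks1: "filter c [a..<b] = a # ks" "filter c [a..<Suc b] = a # ks @ [b]"
    using assms(1-3) by (auto simp: ks_def upt_rec[of a])
  have set_ks: "insert a (set ks) = {i \<in> {a..<b}. c i}"
    by (subst list.set(2)[symmetric], subst ks1(1)[symmetric]) auto
  have inj: "inj_on z (set (a # ks))" and img: "z ` set (a # ks) = V"
    using bij by (auto simp: bij_betw_def set_ks)
  have "successively (\<lambda>i j. i < j \<and> j \<le> i + 3) (a # ks @ [b])"
  proof -
    have "\<forall>i\<ge>a. Suc (Suc i) < Suc b \<longrightarrow> c i \<or> c (Suc i) \<or> c (Suc (Suc i))"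
      using gap by simp
    from successively_filter_upt[of a "Suc b" c, OF less_SucI[OF assms(1)] assms(2) this]
    have "successively (\<lambda>i j. i < j \<and> j \<le> i + 3) (filter c [a..<Suc b])"
      by (elim exE conjE) simp_all
    then show ?thesis by (simp only: ks1(2))
  qed
  then have "successively (\<lambda>i j. A (z i) (z j)) (a # ks @ [b])"
  proof (rule successively_mono)
    fix i j assume "i \<in> set (a # ks @ [b])" "j \<in> set (a # ks @ [b])" "i < j \<and> j \<le> i + 3"
    moreover from this have "a \<le> i" "j \<le> b"
      using \<open>a < b\<close> by (auto simp: ks_def)
    ultimately show "A (z i) (z j)" by (intro near) simp_all
  qed
  then have "successively A (map z (a # ks @ [b]))"
    by (simp only: successively_map)
  then have "successively A (z a # map z ks @ [z a])"
    using assms(4) by simp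
  moreover have "distinct (map z (a # ks))"
    using inj by (subst distinct_map) (auto simp: ks_def)
  moreover have "subseq (map z js) (map z ks)"
    using js by (intro subseq_map sorted_subset_imp_subseq)
      (auto simp: ks_def intro: sorted_wrt_filter sorted_wrt_mono_rel[OF _ sorted_upt])
  ultimately show ?thesis
    unfolding ordered_tour_def using img by (intro exI[of _ "map z ks"]) auto
qed

text \<open>Pauses add no arc, so positions \<open>i\<close> and \<open>j\<close> are joined by a
  walk of at most \<open>j - i\<close> arcs.\<close>

lemma graph_dist_lazy_walk:
  assumes "pair_graph G"
    and vert: "\<And>i. z i \<in> pverts G"
    and step: "\<And>i. i < b \<Longrightarrow> z i = z (Suc i) \<or> (z i, z (Suc i)) \<in> parcs G"
    and "i \<le> j" "j \<le> b"
  shows "graph_dist G (z i) (z j) \<le> ereal (real (j - i))"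
proof -
  interpret pair_graph G by (rule assms)
  have "\<exists>p. awalk (z i) p (z j) \<and> length p \<le> j - i"
    using \<open>i \<le> j\<close> \<open>j \<le> b\<close>
  proof (induction j rule: dec_induct)
    case base
    then show ?case using vert by (intro exI[of _ "[]"]) (auto simp: awalk_Nil_iff)
  next
    case (step m)
    then obtain p where p: "awalk (z i) p (z m)" "length p \<le> m - i" by auto
    consider "z m = z (Suc m)" | "(z m, z (Suc m)) \<in> parcs G"
      using assms(3)[of m] step.prems by auto
    then show ?case
    proof cases
      case 1 then show ?thesis using p by (intro exI[of _ p]) auto
    next
      case 2
      then have "awalk (z m) [(z m, z (Suc m))] (z (Suc m))"
        using vert by (auto simp: awalk_simps)
      with p(1) have "awalk (z i) (p @ [(z m, z (Suc m))]) (z (Suc m))"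
        by (rule awalk_appendI)
      with p(2) step.hyps show ?thesis
        by (intro exI[of _ "p @ [(z m, z (Suc m))]"]) auto
    qed
  qed
  then obtain p where p: "awalk (z i) p (z j)" "length p \<le> j - i" by auto
  have "graph_dist G (z i) (z j) \<le> ereal (awalk_cost (\<lambda>_. 1) p)"
    unfolding graph_dist_def by (rule min_cost_le_walk_cost[OF p(1)])
  also have "\<dots> \<le> ereal (real (j - i))"
    using p(2) by (simp add: awalk_cost_def sum_list_triv)
  finally show ?thesis .
qed


section \<open>Walks passing every vertex twice\<close>

text \<open>Indexing the cycle periodically by all naturals turns a rotation into a shift of the
  argument.\<close>

locale cyclic_sequence =
  fixes f :: "nat \<Rightarrow> 'a" and n :: nat and V :: "'a set" and A :: "'a \<Rightarrow> 'a \<Rightarrow> bool"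
  assumes bij: "bij_betw f {..<n} V"
    and period: "f (i + n) = f i"
    and near: "i \<le> j \<Longrightarrow> j \<le> i + 3 \<Longrightarrow> A (f i) (f j)"
    and sym: "symp A"
begin

lemma ordered_tour_straight:
  assumes "0 < n" "sorted_wrt (<) js" "set js \<subseteq> {0<..<n}"
  shows "ordered_tour V A (f 0) (map f js)"
  by (rule ordered_tour_filter_walk[where b = n and c = "\<lambda>_. True"])
    (use assms bij period[of 0] in \<open>auto intro: near simp: lessThan_def\<close>)

text \<open>
  The walk goes out over \<open>0, ..., n - 1\<close>, pauses there for one step and returns to \<open>0\<close>; \<open>c\<close> tells
  which vertices are visited on the way out. The way back ends by visiting \<open>0\<close> again, which is why
  three consecutive vertices visited on the way out are harmless if \<open>0\<close> is among them.
\<close>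

lemma ordered_tour_fold:
  assumes "0 < n" "c 0"
    and T: "\<And>i. i + 2 < n \<Longrightarrow> c i \<or> c (i + 1) \<or> c (i + 2)"
    and F: "\<And>i. 0 < i \<Longrightarrow> i + 2 < n \<Longrightarrow> \<not> (c i \<and> c (i + 1) \<and> c (i + 2))"
    and js: "sorted_wrt (<) js" "set js \<subseteq> {i \<in> {0<..<n}. c i}"
    and ks: "sorted_wrt (>) ks" "set ks \<subseteq> {i \<in> {0<..<n}. \<not> c i}"
  shows "ordered_tour V A (f 0) (map f (js @ ks))"
proof -
  \<comment> \<open>Reflection at the end: positions \<open>n - 1\<close> and \<open>n\<close> both
    carry vertex \<open>n - 1\<close>, and position \<open>2 * n - 1\<close> carries
    \<open>0\<close>.\<close>
  define y where "y i = (if i < n then i else 2 * n - 1 - i)" for i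
  define c' where "c' i = (if i < n then c i else i = 2 * n - 1 \<or> \<not> c (y i))" for i
  define js' where "js' = js @ map (\<lambda>k. 2 * n - 1 - k) ks"
  have "bij_betw y {i \<in> {0..<2 * n - 1}. c' i} {..<n}"
  proof (rule bij_betw_imageI)
    show "inj_on y {i \<in> {0..<2 * n - 1}. c' i}"
      by (rule inj_onI) (auto simp: y_def c'_def split: if_splits)
    show "y ` {i \<in> {0..<2 * n - 1}. c' i} = {..<n}"
    proof (intro equalityI subsetI)
      fix m assume m: "m \<in> {..<n}"
      show "m \<in> y ` {i \<in> {0..<2 * n - 1}. c' i}"
      proof (cases "c m")
        case True
        with m show ?thesis by (intro image_eqI[of _ _ m]) (auto simp: y_def c'_def)
      next
        \<comment> \<open>The mirror position of \<open>0\<close> is \<open>2 * n - 1\<close>,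
          outside the range, so \<open>0\<close> must be visited on the way out.\<close>
        case False
        with \<open>c 0\<close> have "m \<noteq> 0" by metis
        with m False show ?thesis
          by (intro image_eqI[of _ _ "2 * n - 1 - m"]) (auto simp: y_def c'_def)
      qed
    qed (auto simp: y_def)
  qed
  then have b: "bij_betw (\<lambda>i. f (y i)) {i \<in> {0..<2 * n - 1}. c' i} V"
    using bij_betw_trans[OF _ bij] by (simp add: o_def)
  have near': "A (f (y i)) (f (y j))" if "i \<le> j" "j \<le> i + 3" for i j
  proof (cases "y i \<le> y j")
    case True
    then show ?thesis using that by (intro near) (auto simp: y_def split: if_splits)
  next
    case False
    then have "A (f (y j)) (f (y i))"
      using that by (intro near) (auto simp: y_def split: if_splits)
    then show ?thesis using sym by (rule sympD[rotated])
  qed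
  have gap: "c' i \<or> c' (Suc i) \<or> c' (Suc (Suc i))" if "Suc (Suc i) \<le> 2 * n - 1" for i
  proof -
    consider "i + 2 < n" | "i < n" "n \<le> i + 2" | "n \<le> i" by linarith
    then show ?thesis
    proof cases
      case 1
      then show ?thesis using T[of i] by (auto simp: c'_def)
    next
      case 2
      \<comment> \<open>At the turn the window contains both positions of vertex
        \<open>n - 1\<close>, and one of them is selected.\<close>
      then consider "Suc i = n" | "Suc (Suc i) = n" by linarith
      then show ?thesis
      proof cases
        case 1
        then have "y (Suc i) = i" by (auto simp: y_def)
        then show ?thesis using 1 by (auto simp: c'_def)
      next
        case 2
        then have "y (Suc (Suc i)) = Suc i" by (auto simp: y_def)
        then show ?thesis using 2 by (auto simp: c'_def)
      qed
    next
      \<comment> \<open>On the way back a window mirrors one that avoids \<open>0\<close>, handled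
        by \<open>F\<close>, unless it contains the final position, which is always
        selected.\<close>
      case 3
      show ?thesis
      proof (cases "Suc (Suc i) = 2 * n - 1")
        case False
        then have y: "y (Suc (Suc i)) = 2 * n - 3 - i" "y (Suc i) = 2 * n - 3 - i + 1"
          "y i = 2 * n - 3 - i + 2"
          using 3 that by (auto simp: y_def)
        have "0 < 2 * n - 3 - i" "2 * n - 3 - i + 2 < n"
          using 3 False that by auto
        then have "\<not> (c (y (Suc (Suc i))) \<and> c (y (Suc i)) \<and> c (y i))"
          unfolding y by (rule F)
        then show ?thesis
          using 3 by (auto simp: c'_def)
      qed (use 3 in \<open>auto simp: c'_def\<close>)
    qed
  qed
  have "sorted_wrt (<) (map (\<lambda>k. 2 * n - 1 - k) ks)"
    unfolding sorted_wrt_map by (rule sorted_wrt_mono_rel[OF _ ks(1)]) (use ks(2) in auto)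
  then have js': "sorted_wrt (<) js'"
    unfolding js'_def sorted_wrt_append using js ks(2) by fastforce
  have "set js' \<subseteq> {i \<in> {0<..<2 * n - 1}. c' i}"
    using js(2) ks(2) by (auto simp: js'_def c'_def y_def)
  then have "ordered_tour V A (f (y 0)) (map (\<lambda>i. f (y i)) js')"
    by (intro ordered_tour_filter_walk[where b = "2 * n - 1" and c = c'])
      (use assms(1,2) gap near' b js' in \<open>auto simp: c'_def y_def\<close>)
  moreover have "map y js' = js @ ks"
    unfolding js'_def map_append using js(2) ks(2)
    by (intro arg_cong2[of _ _ _ _ "(@)"]) (auto simp: y_def intro!: map_idI)
  moreover have "map (\<lambda>i. f (y i)) js' = map f (map y js')"
    by simp
  ultimately show ?thesis using \<open>0 < n\<close> by (simp only:) (simp add: y_def)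
qed

text \<open>
  The walk goes around twice; \<open>c\<close> tells which vertices are visited in the first round. The
  conditions on \<open>c 1\<close> and \<open>c (n - 2) \<or> c (n - 1)\<close> concern the passage between the rounds,
  where \<open>0\<close> is skipped.
\<close>

lemma ordered_tour_wrap:
  assumes "2 \<le> n" "c 0" "\<not> c 1" "c (n - 2) \<or> c (n - 1)"
    and T: "\<And>i. i + 2 < n \<Longrightarrow> c i \<or> c (i + 1) \<or> c (i + 2)"
    and F: "\<And>i. i + 2 < n \<Longrightarrow> \<not> (c i \<and> c (i + 1) \<and> c (i + 2))"
    and js: "sorted_wrt (<) js" "set js \<subseteq> {i \<in> {0<..<n}. c i}"
    and ks: "sorted_wrt (<) ks" "set ks \<subseteq> {i \<in> {0<..<n}. \<not> c i}"
  shows "ordered_tour V A (f 0) (map f (js @ ks))"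
proof -
  \<comment> \<open>\<open>y\<close> only serves to count visits; as \<open>f (y i) = f i\<close> by
    periodicity, the walk itself is \<open>f\<close>.\<close>
  define y where "y i = (if i < n then i else i - n)" for i
  define c' where "c' i = (if i < n then c i else i = 2 * n \<or> \<not> c (i - n))" for i
  define js' where "js' = js @ map (\<lambda>k. k + n) ks"
  have fy: "f (y i) = f i" for i
    using period[of "i - n"] by (cases "i < n") (simp_all add: y_def)
  have "bij_betw y {i \<in> {0..<2 * n}. c' i} {..<n}"
  proof (rule bij_betw_imageI)
    show "inj_on y {i \<in> {0..<2 * n}. c' i}"
      by (rule inj_onI) (auto simp: y_def c'_def split: if_splits)
    show "y ` {i \<in> {0..<2 * n}. c' i} = {..<n}"
    proof (intro equalityI subsetI)
      fix m assume m: "m \<in> {..<n}"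
      show "m \<in> y ` {i \<in> {0..<2 * n}. c' i}"
      proof (cases "c m")
        case True
        with m show ?thesis by (intro image_eqI[of _ _ m]) (auto simp: y_def c'_def)
      next
        case False
        with m show ?thesis
          by (intro image_eqI[of _ _ "m + n"]) (auto simp: y_def c'_def)
      qed
    qed (auto simp: y_def)
  qed
  then have b: "bij_betw f {i \<in> {0..<2 * n}. c' i} V"
    using bij_betw_trans[OF _ bij, of y] unfolding o_def fy by blast
  have gap: "c' i \<or> c' (Suc i) \<or> c' (Suc (Suc i))" if i: "Suc (Suc i) \<le> 2 * n" for i
  proof -
    consider "i + 2 < n" | "i + 2 = n" | "i + 1 = n" | "n \<le> i" "i + 2 < 2 * n" | "i + 2 = 2 * n"
      using i by linarith
    then show ?thesis
    proof cases
      case 1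
      then show ?thesis using T[of i] by (auto simp: c'_def)
    next
      case 2
      then have "i = n - 2" "Suc i = n - 1" using \<open>2 \<le> n\<close> by auto
      then show ?thesis using assms(1,4) by (auto simp: c'_def)
    next
      case 3
      then have "Suc (Suc i) - n = 1" "n \<le> Suc (Suc i)" by auto
      then show ?thesis using assms(3) by (auto simp: c'_def)
    next
      case 4
      then show ?thesis using F[of "i - n"] by (auto simp: c'_def Suc_diff_le)
    next
      case 5
      then show ?thesis using \<open>2 \<le> n\<close> by (auto simp: c'_def)
    qed
  qed
  have "sorted_wrt (<) (map (\<lambda>k. k + n) ks)"
    using ks(1) by (simp add: sorted_wrt_map)
  then have js': "sorted_wrt (<) js'"
    unfolding js'_def sorted_wrt_append using js ks(2) by fastforce
  have "set js' \<subseteq> {i \<in> {0<..<2 * n}. c' i}"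
    using js(2) ks(2) by (auto simp: js'_def c'_def)
  then have "ordered_tour V A (f 0) (map f js')"
    by (intro ordered_tour_filter_walk[where b = "2 * n" and c = c'])
      (use assms(1,2) gap near b js' period[of 0] period[of n] in \<open>auto simp: c'_def mult_2\<close>)
  then show ?thesis by (simp add: js'_def period o_def)
qed

end

section \<open>Splitting the vertices between the two passes\<close>

lemma alternating_extension:
  fixes g :: "nat \<Rightarrow> bool"
  obtains r where "r 0 = g 0" "\<And>i. r (Suc i) = (if Suc i \<in> P then g (Suc i) else \<not> r i)"
  by (rule that[of "rec_nat (g 0) (\<lambda>i b. if Suc i \<in> P then g (Suc i) else \<not> b)"]) simp_all

text \<open>
  If three consecutive points on one side of \<open>q\<close> have equal values, then the two farther from
  \<open>q\<close> belong to \<open>P - {q}\<close>. Below, at most one pair of neighbouring prescribed points other than \<open>0\<close>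
  has equal values, and \<open>q\<close> is taken from that pair, which excludes such triples.
\<close>

lemma alternating_extension_from:
  fixes g :: "nat \<Rightarrow> bool"
  assumes "q \<in> P"
  obtains c where "\<And>i. i \<in> P \<Longrightarrow> c i = g i"
    and "\<And>i. i < q \<Longrightarrow> i \<notin> P \<Longrightarrow> c i \<noteq> c (Suc i)"
    and "\<And>i. q \<le> i \<Longrightarrow> Suc i \<notin> P \<Longrightarrow> c (Suc i) \<noteq> c i"
proof -
  obtain r where r: "r 0 = g 0" "\<And>i. r (Suc i) = (if Suc i \<in> P then g (Suc i) else \<not> r i)"
    using alternating_extension[of g P] by blast
  \<comment> \<open>The same extension run downwards: \<open>l j\<close> is the value at
    \<open>q - j\<close>. It meets \<open>r\<close> at \<open>q\<close> with the common value
    \<open>g q\<close>, since \<open>q\<close> lies in \<open>P\<close>.\<close>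
  obtain l where l: "l 0 = g (q - 0)"
    "\<And>i. l (Suc i) = (if Suc i \<in> {j. q - j \<in> P} then g (q - Suc i) else \<not> l i)"
    using alternating_extension[of "\<lambda>j. g (q - j)" "{j. q - j \<in> P}"] by blast
  have rP: "r i = g i" if "i \<in> P" for i
    using r that by (cases i) auto
  have lP: "l (q - i) = g i" if "i \<in> P" "i \<le> q" for i
  proof (cases "q - i")
    case (Suc k)
    then have "q - Suc k = i" using that by simp
    then show ?thesis using l(2)[of k] that Suc by simp
  qed (use l that in auto)
  show ?thesis
  proof (rule that[of "\<lambda>i. if i \<le> q then l (q - i) else r i"])
    fix i assume "i < q" "i \<notin> P"
    then show "(if i \<le> q then l (q - i) else r i) \<noteq> (if Suc i \<le> q then l (q - Suc i) else r (Suc i))"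
      using l(2)[of "q - Suc i"] by (simp add: Suc_diff_Suc)
  next
    fix i assume "q \<le> i" "Suc i \<notin> P"
    then show "(if Suc i \<le> q then l (q - Suc i) else r (Suc i)) \<noteq> (if i \<le> q then l (q - i) else r i)"
      using r(2)[of i] rP[OF assms] lP[OF assms] by (cases "i = q") auto
  qed (use rP lP in auto)
qed

context cyclic_sequence
begin

text \<open>The values at \<open>0, q1, q2, q3, q4\<close> alternate, so extending upwards from
  \<open>0\<close> suffices: a constant triple would end in two adjacent prescribed points of equal
  value.\<close>

lemma ordered_tour_02413:
  assumes q: "0 < q1" "q1 < q2" "q2 < q3" "q3 < q4" "q4 < n"
  shows "ordered_tour V A (f 0) [f q2, f q4, f q1, f q3]"
proof -
  obtain c where c: "\<And>i. i \<in> {0, q1, q2, q3, q4} \<Longrightarrow> c i = (i \<in> {0, q2, q4})"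
    and "\<And>i. i < 0 \<Longrightarrow> i \<notin> {0, q1, q2, q3, q4} \<Longrightarrow> c i \<noteq> c (Suc i)"
    and r: "\<And>i. 0 \<le> i \<Longrightarrow> Suc i \<notin> {0, q1, q2, q3, q4} \<Longrightarrow> c (Suc i) \<noteq> c i"
    by (rule alternating_extension_from[of 0 "{0, q1, q2, q3, q4}" "\<lambda>i. i \<in> {0, q2, q4}"]) auto
  have cq: "c 0" "\<not> c q1" "c q2" "\<not> c q3" "c q4"
    using c[of 0] c[of q1] c[of q2] c[of q3] c[of q4] q by auto
  have win: "\<not> (c i = c (i + 1) \<and> c (i + 1) = c (i + 2))" for i
  proof
    assume e: "c i = c (i + 1) \<and> c (i + 1) = c (i + 2)"
    then have "Suc i \<in> {0, q1, q2, q3, q4}" "Suc (Suc i) \<in> {0, q1, q2, q3, q4}"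
      using r[of i] r[of "Suc i"] by auto
    with e cq q show False by auto
  qed
  have "ordered_tour V A (f 0) (map f ([q2, q4] @ [q1, q3]))"
  proof (rule ordered_tour_wrap[of c])
    \<comment> \<open>Vertex \<open>1\<close> is \<open>q1\<close> or flips the value of
      \<open>0\<close>; likewise \<open>n - 1\<close> is \<open>q4\<close> or differs from
      \<open>n - 2\<close>.\<close>
    show "\<not> c 1"
    proof (cases "q1 = 1")
      case False
      then have "Suc 0 \<notin> {0, q1, q2, q3, q4}" using q by auto
      then show ?thesis using r[of 0] cq by auto
    qed (use cq in auto)
    show "c (n - 2) \<or> c (n - 1)"
    proof (cases "q4 = n - 1")
      case False
      then have "Suc (n - 2) \<notin> {0, q1, q2, q3, q4}" using q by auto
      then have "c (Suc (n - 2)) \<noteq> c (n - 2)" by (intro r) auto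
      moreover have "Suc (n - 2) = n - 1" using q by auto
      ultimately show ?thesis by auto
    qed (use cq in auto)
  qed (use q cq win in auto)
  then show ?thesis by simp
qed

text \<open>The equal pair is \<open>q1\<close>, \<open>q2\<close>, and \<open>q1\<close> is the
  centre. A constant triple starting at or above it would end in two adjacent points among
  \<open>q2, q3, q4\<close>, whose values alternate; one starting below it starts at
  \<open>0\<close>, which \<open>ordered_tour_fold\<close> tolerates.\<close>

lemma ordered_tour_01243:
  assumes q: "0 < q1" "q1 < q2" "q2 < q3" "q3 < q4" "q4 < n"
  shows "ordered_tour V A (f 0) [f q1, f q2, f q4, f q3]"
proof -
  let ?P = "{0, q1, q2, q3, q4}"
  obtain c where c: "\<And>i. i \<in> ?P \<Longrightarrow> c i = (i \<in> {0, q1, q2, q4})"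
    and l: "\<And>i. i < q1 \<Longrightarrow> i \<notin> ?P \<Longrightarrow> c i \<noteq> c (Suc i)"
    and r: "\<And>i. q1 \<le> i \<Longrightarrow> Suc i \<notin> ?P \<Longrightarrow> c (Suc i) \<noteq> c i"
    by (rule alternating_extension_from[of q1 ?P "\<lambda>i. i \<in> {0, q1, q2, q4}"]) auto
  have cq: "c 0" "c q1" "c q2" "\<not> c q3" "c q4"
    using c[of 0] c[of q1] c[of q2] c[of q3] c[of q4] q by auto
  have win: "i = 0 \<and> c 0 \<and> c 1 \<and> c 2" if e: "c i = c (i + 1) \<and> c (i + 1) = c (i + 2)" for i
  proof (cases "i < q1")
    case True
    then have "i \<in> ?P" using l[of i] e by auto
    with True q have "i = 0" by auto
    with e cq show ?thesis by (auto simp: numeral_2_eq_2)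
  next
    case False
    then have "Suc i \<in> ?P" "Suc (Suc i) \<in> ?P"
      using e r[of i] r[of "Suc i"] by auto
    with False e cq q show ?thesis by auto
  qed
  have "ordered_tour V A (f 0) (map f ([q1, q2, q4] @ [q3]))"
  proof (rule ordered_tour_fold[of c])
    fix i show "c i \<or> c (i + 1) \<or> c (i + 2)" using win[of i] by metis
  next
    fix i :: nat assume "0 < i"
    then show "\<not> (c i \<and> c (i + 1) \<and> c (i + 2))" using win[of i] by blast
  qed (use q cq in auto)
  then show ?thesis by simp
qed

text \<open>The equal pair is \<open>q3\<close>, \<open>q4\<close>, and \<open>q4\<close> is the
  centre. A constant triple with \<open>0 < i\<close> and \<open>Suc i < q4\<close> would begin with
  two adjacent points among \<open>q1, q2, q3\<close>, whose values alternate; beyond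
  \<open>q4\<close> nothing is prescribed.\<close>

lemma ordered_tour_01342:
  assumes q: "0 < q1" "q1 < q2" "q2 < q3" "q3 < q4" "q4 < n"
  shows "ordered_tour V A (f 0) [f q1, f q3, f q4, f q2]"
proof -
  let ?P = "{0, q1, q2, q3, q4}"
  obtain c where c: "\<And>i. i \<in> ?P \<Longrightarrow> c i = (i \<in> {0, q1, q3, q4})"
    and l: "\<And>i. i < q4 \<Longrightarrow> i \<notin> ?P \<Longrightarrow> c i \<noteq> c (Suc i)"
    and r: "\<And>i. q4 \<le> i \<Longrightarrow> Suc i \<notin> ?P \<Longrightarrow> c (Suc i) \<noteq> c i"
    by (rule alternating_extension_from[of q4 ?P "\<lambda>i. i \<in> {0, q1, q3, q4}"]) auto
  have cq: "c 0" "c q1" "\<not> c q2" "c q3" "c q4"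
    using c[of 0] c[of q1] c[of q2] c[of q3] c[of q4] q by auto
  have win: "i = 0 \<and> c 0 \<and> c 1 \<and> c 2" if e: "c i = c (i + 1) \<and> c (i + 1) = c (i + 2)" for i
  proof (cases "i = 0")
    case True
    with e cq show ?thesis by (auto simp: numeral_2_eq_2)
  next
    case False
    show ?thesis
    proof (cases "Suc i < q4")
      case True
      then have "i \<in> ?P" "Suc i \<in> ?P"
        using e l[of i] l[of "Suc i"] by auto
      with True False e cq q show ?thesis by auto
    next
      case False
      have "Suc (Suc i) \<notin> ?P" using False q by auto
      with False e r[of "Suc i"] show ?thesis by auto
    qed
  qed
  have "ordered_tour V A (f 0) (map f ([q1, q3, q4] @ [q2]))"
  proof (rule ordered_tour_fold[of c])
    fix i show "c i \<or> c (i + 1) \<or> c (i + 2)" using win[of i] by metis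
  next
    fix i :: nat assume "0 < i"
    then show "\<not> (c i \<and> c (i + 1) \<and> c (i + 2))" using win[of i] by blast
  qed (use q cq in auto)
  then show ?thesis by simp
qed

section \<open>Change of base point and the list of all orders\<close>

text \<open>Shifting by one trades \<open>f s\<close> for \<open>f (s + n) = f s\<close>, so the
  image stays \<open>V\<close>; injectivity follows by counting.\<close>

lemma shift: "cyclic_sequence (\<lambda>i. f (s + i)) n V A"
proof
  show "bij_betw (\<lambda>i. f (s + i)) {..<n} V"
  proof (induction s)
    case (Suc s)
    have "(\<lambda>i. f (Suc s + i)) ` {..<n} = (\<lambda>i. f (s + i)) ` {..<n}"
    proof (cases n)
      case (Suc m)
      have "(\<lambda>i. f (s + i)) ` {..<Suc m} = insert (f s) ((\<lambda>i. f (s + i)) ` Suc ` {..<m})"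
        by (simp add: lessThan_Suc_eq_insert_0)
      moreover have "f (Suc s + m) = f s" using period[of s] Suc by simp
      ultimately show ?thesis using Suc by (simp add: lessThan_Suc image_image)
    qed simp
    moreover have "card ((\<lambda>i. f (s + i)) ` {..<n}) = card {..<n}"
      using Suc by (auto simp: bij_betw_def dest: card_image)
    ultimately have "card ((\<lambda>i. f (Suc s + i)) ` {..<n}) = card {..<n}" by simp
    then have "inj_on (\<lambda>i. f (Suc s + i)) {..<n}" by (rule eq_card_imp_inj_on[rotated]) simp
    with Suc \<open>_ ` _ = _ ` _\<close> show ?case by (simp add: bij_betw_def)
  qed (simp add: bij)
qed (use period near sym in \<open>auto simp: add.assoc[symmetric]\<close>)


abbreviation tour :: "nat \<Rightarrow> nat \<Rightarrow> nat \<Rightarrow> nat \<Rightarrow> nat \<Rightarrow> bool" where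
  "tour a b c d e \<equiv> ordered_tour V A (f a) [f b, f c, f d, f e]"

lemma tour_rotate: "tour a b c d e \<Longrightarrow> tour b c d e a"
  using ordered_tour_rotate by fastforce

lemma tour_rev: "tour a b c d e \<Longrightarrow> tour a e d c b"
  using ordered_tour_rev[OF _ sym] by fastforce

lemma tour_base:
  assumes "x0 < x1" "x1 < x2" "x2 < x3" "x3 < x4" "x4 < x0 + n"
  shows "tour x0 x1 x2 x3 x4" "tour x0 x2 x4 x1 x3" "tour x0 x1 x2 x4 x3" "tour x0 x1 x3 x4 x2"
proof -
  interpret s: cyclic_sequence "\<lambda>i. f (x0 + i)" n V A
    by (rule shift)
  have q: "0 < x1 - x0" "x1 - x0 < x2 - x0" "x2 - x0 < x3 - x0" "x3 - x0 < x4 - x0" "x4 - x0 < n"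
    using assms by auto
  have x: "x0 + (x1 - x0) = x1" "x0 + (x2 - x0) = x2" "x0 + (x3 - x0) = x3" "x0 + (x4 - x0) = x4"
    using assms by auto
  have "ordered_tour V A (f (x0 + 0)) (map (\<lambda>i. f (x0 + i)) [x1 - x0, x2 - x0, x3 - x0, x4 - x0])"
    by (rule s.ordered_tour_straight) (use q in auto)
  then show "tour x0 x1 x2 x3 x4" by (simp add: x)
  show "tour x0 x2 x4 x1 x3" "tour x0 x1 x2 x4 x3" "tour x0 x1 x3 x4 x2"
    using s.ordered_tour_02413[OF q] s.ordered_tour_01243[OF q] s.ordered_tour_01342[OF q]
    by (simp_all add: x)
qed

lemma tour_all_orders:
  assumes "distinct [b, c, d, e]" "set [b, c, d, e] \<subseteq> {a<..<a + n}"
  shows "tour a b c d e"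
proof -
  have per: "f (i + n) = f i" for i by (rule period)
  \<comment> \<open>Up to reversal, all twelve cyclic orders: ten of them arise from \<open>01243\<close> and \<open>01342\<close> by
    moving the base point from \<open>a\<close> to \<open>x1\<close>, \<open>x2\<close>, \<open>x3\<close>, \<open>x4\<close>.\<close>
  have tours: "tour a x1 x2 x3 x4" "tour a x2 x4 x1 x3"
    "tour a x1 x2 x4 x3" "tour a x4 x1 x2 x3" "tour a x2 x3 x4 x1" "tour a x2 x1 x3 x4"
    "tour a x1 x3 x2 x4"
    "tour a x1 x3 x4 x2" "tour a x3 x1 x2 x4" "tour a x1 x4 x2 x3" "tour a x3 x4 x1 x2"
    "tour a x2 x3 x1 x4"
    if "a < x1" "x1 < x2" "x2 < x3" "x3 < x4" "x4 < a + n" for x1 x2 x3 x4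
  proof -
    \<comment> \<open>Raising the passed points by \<open>n\<close> keeps each rotated quintuple
      increasing within one period of its first member; \<open>per\<close> removes the
      \<open>n\<close> again. Thus \<open>t\<close> holds four tours for each of the base points
      \<open>a, x1, x2, x3, x4\<close>.\<close>
    have r1: "x1 < x2" "x2 < x3" "x3 < x4" "x4 < a + n" "a + n < x1 + n"
      and r2: "x2 < x3" "x3 < x4" "x4 < a + n" "a + n < x1 + n" "x1 + n < x2 + n"
      and r3: "x3 < x4" "x4 < a + n" "a + n < x1 + n" "x1 + n < x2 + n" "x2 + n < x3 + n"
      and r4: "x4 < a + n" "a + n < x1 + n" "x1 + n < x2 + n" "x2 + n < x3 + n" "x3 + n < x4 + n"
      using that by auto
    note t = tour_base[OF that] tour_base[OF r1, unfolded per] tour_base[OF r2, unfolded per]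
      tour_base[OF r3, unfolded per] tour_base[OF r4, unfolded per]
    show "tour a x1 x2 x3 x4" by (rule t(1))
    show "tour a x2 x4 x1 x3" by (rule t(2))
    show "tour a x1 x2 x4 x3" by (rule t(3))
    show "tour a x4 x1 x2 x3" by (rule t(7)[THEN tour_rotate, THEN tour_rotate, THEN tour_rotate])
    show "tour a x2 x3 x4 x1" by (rule t(11)[THEN tour_rotate, THEN tour_rotate, THEN tour_rotate, THEN tour_rotate])
    show "tour a x2 x1 x3 x4" by (rule t(15)[THEN tour_rotate, THEN tour_rotate])
    show "tour a x1 x3 x2 x4" by (rule t(19)[THEN tour_rotate])
    show "tour a x1 x3 x4 x2" by (rule t(4))
    show "tour a x3 x1 x2 x4" by (rule t(8)[THEN tour_rotate, THEN tour_rotate, THEN tour_rotate])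
    show "tour a x1 x4 x2 x3" by (rule t(12)[THEN tour_rotate, THEN tour_rotate])
    show "tour a x3 x4 x1 x2" by (rule t(16)[THEN tour_rotate, THEN tour_rotate, THEN tour_rotate, THEN tour_rotate])
    show "tour a x2 x3 x1 x4" by (rule t(20)[THEN tour_rotate])
  qed
  have "a < b" "a < c" "a < d" "a < e" "b < a + n" "c < a + n" "d < a + n" "e < a + n"
    using assms(2) by auto
  moreover have "b < c \<or> c < b" "b < d \<or> d < b" "b < e \<or> e < b" "c < d \<or> d < c"
    "c < e \<or> e < c" "d < e \<or> e < d"
    using assms(1) by auto
  \<comment> \<open>Each of the 24 orders is one of the twelve \<open>tours\<close> or a reversal;
    inconsistent comparisons contradict transitivity.\<close>
  ultimately show ?thesis
    by (elim disjE) (blast intro: tours tours[THEN tour_rev] dest: less_trans less_asym)+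
qed

end

section \<open>The cube of the cycle graph\<close>

lemma cyclic_sequence_cycle_graph:
  assumes "2 \<le> n"
  shows "cyclic_sequence (\<lambda>i. i mod n) n {..<n}
    (\<lambda>v w. graph_dist (cycle_graph n) v w \<le> ereal (real 3))"
proof
  show "bij_betw (\<lambda>i. i mod n) {..<n} {..<n}"
    by (rule bij_betw_byWitness[of _ "\<lambda>i. i"]) auto
  show "symp (\<lambda>v w. graph_dist (cycle_graph n) v w \<le> ereal (real 3))"
    using graph_dist_commute[OF pair_graph_cycle_graph[OF assms]] by (simp add: symp_def)
  fix i j :: nat assume "i \<le> j" "j \<le> i + 3"
  have "graph_dist (cycle_graph n) (i mod n) (j mod n) \<le> ereal (real (j - i))"
    by (rule graph_dist_lazy_walk[OF pair_graph_cycle_graph[OF assms], of "\<lambda>i. i mod n" j])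
      (use assms \<open>i \<le> j\<close> in \<open>auto simp: cycle_graph_def mod_Suc_eq\<close>)
  also have "\<dots> \<le> ereal (real 3)"
    using \<open>j \<le> i + 3\<close> by simp
  finally show "graph_dist (cycle_graph n) (i mod n) (j mod n) \<le> ereal (real 3)" .
qed simp

theorem theorem6p1:
  fixes n :: nat
  assumes "n \<ge> 5"
  shows "k_ordered_hamiltonian 5 (graph_power (cycle_graph n) 3)"
proof (rule k_ordered_hamiltonian_graph_power)
  have verts: "pverts (cycle_graph n) = {..<n}"
    by (simp add: cycle_graph_def)
  interpret cyclic_sequence "\<lambda>i. i mod n" n "{..<n}"
    "\<lambda>v w. graph_dist (cycle_graph n) v w \<le> ereal (real 3)"
    by (rule cyclic_sequence_cycle_graph) (use assms in simp)
  show "pair_graph (cycle_graph n)"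
    by (rule pair_graph_cycle_graph) (use assms in simp)
  show "3 \<le> card (pverts (cycle_graph n))"
    using assms by (simp add: verts)
  fix v ws assume ws: "distinct (v # ws)" "length (v # ws) = 5" "set (v # ws) \<subseteq> pverts (cycle_graph n)"
  \<comment> \<open>Lifting the vertices below \<open>v\<close> by \<open>n\<close> puts all four
    strictly between \<open>v\<close> and \<open>v + n\<close>, as \<open>tour_all_orders\<close>
    requires.\<close>
  define up where "up w = (if w < v then w + n else w)" for w
  have up: "up w mod n = w" if "w < n" for w
    using that by (simp add: up_def)
  obtain b c d e where bcde: "ws = [b, c, d, e]"
    using ws(2) by (auto simp: numeral_eq_Suc length_Suc_conv)
  have lt: "v < n" "b < n" "c < n" "d < n" "e < n"
    using ws(3) by (auto simp: bcde verts)
  have "tour v (up b) (up c) (up d) (up e)"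
    by (rule tour_all_orders) (use ws(1) lt in \<open>auto simp: up_def bcde nat_neq_iff\<close>)
  then show "ordered_tour (pverts (cycle_graph n))
      (\<lambda>v w. graph_dist (cycle_graph n) v w \<le> ereal (real 3)) v ws"
    using lt by (simp add: up bcde verts)
qed simp

end
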